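(* Let $I\subset\mathbb{R}$ be an open interval, $\alpha<\beta$ with $[\alpha,\beta]\subset I$, $D\in C^1(I)$ and $f\in C^2(I)$. Suppose that $D(u)>0$ for every $u\in I\setminus\{\alpha,\beta\}$, that for some $m\ge 1$ $$D(s)\sim(s-\alpha)^m \ \text{ as } s\to\alpha^+,\qquad D(s)\sim(\beta-s)^m\ \text{ as } s\to\beta^-,$$ that $f(\alpha)=f(\beta)=0$, $f'(\alpha)>0$, $f'(\beta)>0$, and that $$\int_\alpha^\beta f(s)D(s)\,ds=0,\qquad \int_\alpha^u f(s)D(s)\,ds>0\quad\text{for all }u\in I,\ u\neq\alpha,\beta .$$ Let $a<b$, let $N\ge1$ be an integer and let $h_1,\dots,h_N$ be any real numbers with $a<h_1<h_2<\cdots<h_N<b$. Then there exists $\bar\varepsilon>0$ such that for every $\varepsilon\in(0,\bar\varepsilon)$ there exist two stationary solutions $\varphi_1$ and $\varphi_2$ of $$u_t=\varepsilon^2(D(u)u_x)_x-f(u)\ \text{ in }(a,b),\qquad u_x(a,t)=u_x(b,t)=0,$$ with $\varphi_1(a)=\alpha$ and $\varphi_2(a)=\beta$, respectively, oscillating between $\alpha$ and $\beta$, and satisfying, for $i=1,2$ and $x\in[a,b]$, $$\varphi_i(x)=\frac{\alpha+\beta}{2}\quad\text{if and only if}\quad x\in\{h_1,h_2,\dots,h_N\}.$$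
   Context: Here $g_1(s)\sim g_2(s)$ as $s\to s_0$ means that $g_1(s)/g_2(s)$ tends to a finite, strictly positive limit. Stationary solutions are time-independent functions $\varphi$ on $[a,b]$ solving $\varepsilon^2(D(\varphi)\varphi')'-f(\varphi)=0$ with $\varphi'(a)=\varphi'(b)=0$. Since $D$ vanishes at $\alpha$ and $\beta$, the derivative may fail to exist at points where the solution reaches $\alpha$ or $\beta$; the equation is understood in the sense that $\varphi$ is continuous with values in $[\alpha,\beta]$, $K(\varphi)$ is $C^2$ and $\varepsilon^2(K(\varphi))''=f(\varphi)$, where $K(u):=\int_\alpha^u D(s)\,ds$. "Oscillating between $\alpha$ and $\beta$" means that $\varphi_i$ takes values in $[\alpha,\beta]$ and attains the values $\alpha$ and $\beta$ alternately on the successive intervals into which $h_1,\dots,h_N$ divide $[a,b]$. *)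

theory Defs
  imports "HOL-Analysis.Analysis"
begin

text \<open>\<open>g\<^sub>1(s)/g\<^sub>2(s)\<close> tends to a finite positive limit, not necessarily 1; this is weaker than
  \<open>asymp_equiv\<close> of the library.\<close>

definition same_order :: "(real \<Rightarrow> real) \<Rightarrow> (real \<Rightarrow> real) \<Rightarrow> real filter \<Rightarrow> bool" where
  "same_order g1 g2 F \<longleftrightarrow> (\<exists>L>0. ((\<lambda>s. g1 s / g2 s) \<longlongrightarrow> L) F)"

text \<open>The function \<open>K(u)\<close>. The interval integral is oriented, so \<open>u < \<alpha>\<close> is allowed.\<close>

definition D_primitive :: "(real \<Rightarrow> real) \<Rightarrow> real \<Rightarrow> real \<Rightarrow> real" where
  "D_primitive D \<alpha> u = (LBINT s=ereal \<alpha>..ereal u. D s)"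

text \<open>Solutions of \<open>\<epsilon>\<^sup>2 (D(\<phi>) \<phi>')' = f(\<phi>)\<close> on \<open>[a,b]\<close> with homogeneous Neumann conditions.
  As \<open>D\<close> vanishes at \<open>\<alpha>\<close> and \<open>\<beta>\<close>, \<open>\<phi>\<close> itself need not be differentiable in the interior; the
  equation is imposed on \<open>K(\<phi>)\<close> for \<open>K = D_primitive D \<alpha>\<close>, whose first and second derivatives are \<open>v'\<close> and \<open>v''\<close>.
  Derivatives at \<open>a\<close> and \<open>b\<close> are one-sided.\<close>

definition stationary_solution ::
  "(real \<Rightarrow> real) \<Rightarrow> (real \<Rightarrow> real) \<Rightarrow> real \<Rightarrow> real \<Rightarrow> real \<Rightarrow> real \<Rightarrow> real \<Rightarrow> (real \<Rightarrow> real) \<Rightarrow> bool" where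
  "stationary_solution D f \<alpha> \<beta> \<epsilon> a b \<phi> \<longleftrightarrow>
     continuous_on {a..b} \<phi> \<and>
     (\<forall>x\<in>{a..b}. \<phi> x \<in> {\<alpha>..\<beta>}) \<and>
     (\<exists>v' v''. (\<forall>x\<in>{a..b}. ((\<lambda>y. D_primitive D \<alpha> (\<phi> y)) has_real_derivative v' x) (at x within {a..b})) \<and>
               (\<forall>x\<in>{a..b}. (v' has_real_derivative v'' x) (at x within {a..b})) \<and>
               continuous_on {a..b} v'' \<and>
               (\<forall>x\<in>{a..b}. \<epsilon>\<^sup>2 * v'' x = f (\<phi> x))) \<and>
     (\<phi> has_real_derivative 0) (at a within {a..b}) \<and>
     (\<phi> has_real_derivative 0) (at b within {a..b})"

text \<open>The points \<open>a < h 1 < \<dots> < h N < b\<close> cut \<open>[a,b]\<close> into the pieces with index \<open>0,\<dots>,N\<close>.\<close>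

definition piece :: "real \<Rightarrow> real \<Rightarrow> nat \<Rightarrow> (nat \<Rightarrow> real) \<Rightarrow> nat \<Rightarrow> real set" where
  "piece a b N h j = {(if j = 0 then a else h j)..(if j = N then b else h (Suc j))}"

text \<open>\<open>\<phi>\<close> stays between \<open>p\<close> and \<open>q\<close> and attains \<open>p\<close>, \<open>q\<close>, \<open>p\<close>, \<open>\<dots>\<close> (one of the two on each piece),
  starting with \<open>p\<close>; both \<open>p < q\<close> and \<open>q < p\<close> are used.\<close>

definition oscillates ::
  "real \<Rightarrow> real \<Rightarrow> real \<Rightarrow> real \<Rightarrow> nat \<Rightarrow> (nat \<Rightarrow> real) \<Rightarrow> (real \<Rightarrow> real) \<Rightarrow> bool" where
  "oscillates p q a b N h \<phi> \<longleftrightarrow>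
     (\<forall>x\<in>{a..b}. \<phi> x \<in> {min p q..max p q}) \<and>
     (\<forall>j\<le>N. if even j
             then p \<in> \<phi> ` piece a b N h j \<and> q \<notin> \<phi> ` piece a b N h j
             else q \<in> \<phi> ` piece a b N h j \<and> p \<notin> \<phi> ` piece a b N h j)"

end

theory Submission
  imports Defs
begin

text \<open>
  Let \<open>G u\<close> be the integral of \<open>f * D\<close> from \<open>\<alpha>\<close> to \<open>u\<close>. Multiplying \<open>K(\<Phi>)'' = f(\<Phi>)\<close> by
  \<open>K(\<Phi>)' = D(\<Phi>) \<Phi>'\<close> and integrating gives the conservation law \<open>(D(\<Phi>) \<Phi>')\<^sup>2 = 2 G(\<Phi>) + const\<close>.
  On the zero energy level the increasing solution from \<open>\<alpha>\<close> to \<open>\<beta>\<close> is the inverse of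
  \<open>T u\<close>, the integral of \<open>D / sqrt (2 G)\<close>. For nondegenerate \<open>D\<close> this integral diverges at both ends, but
  here \<open>D\<close> is of order \<open>(s - \<alpha>)\<^sup>m\<close> and \<open>G\<close> at least of order \<open>(s - \<alpha>)\<close> to the power \<open>m + 2\<close>, so the integrand is
  at most of order \<open>(s - \<alpha>)\<close> to the power \<open>m/2 - 1\<close>, which is integrable because \<open>m > 0\<close>
  (\<open>transition_time_integrable\<close>). The transition therefore takes finite time, and beyond it
  \<open>\<Phi>\<close> can be continued by the constants \<open>\<alpha>\<close> and \<open>\<beta>\<close>, which are equilibria because \<open>f\<close> vanishes there.
  The continued \<open>K(\<Phi>)\<close> stays twice continuously differentiable, since \<open>K(\<Phi>)' = sqrt (2 G(\<Phi>))\<close> and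
  \<open>K(\<Phi>)'' = f(\<Phi>)\<close> both tend to zero at the junctions (\<open>transition_profile\<close>).

  Such compactly supported transitions can be placed anywhere, provided that they do not overlap. The equation
  is autonomous and invariant under reflection, so both \<open>\<Phi> ((x - p) / \<epsilon>)\<close> and
  \<open>\<Phi> ((p - x) / \<epsilon>)\<close> solve it with parameter \<open>\<epsilon>\<close>, and each leaves the constants only in a
  neighbourhood of \<open>p\<close> of radius of order \<open>\<epsilon>\<close>. Put one at every \<open>h j\<close>, alternately increasing and decreasing. All of
  them are captured by the single formula \<open>\<Phi> (\<sigma> * signed_dist H x / \<epsilon>)\<close>, where \<open>H\<close> is the set of the
  \<open>h j\<close>, \<open>signed_dist H\<close> is the zigzag function that measures the distance to \<open>H\<close> and changes sign at each
  point of \<open>H\<close>, and the sign \<open>\<sigma>\<close> selects one of the two solutions. Near every point of the line this formula is either one shifted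
  transition or constant (\<open>layered_solution\<close>), and the oscillation is read off from the signs of the zigzag
  (\<open>signed_dist_transitions\<close>).
\<close>

section \<open>Derivatives across exceptional points\<close>

text \<open>The fundamental theorem of calculus tolerates finitely many exceptional points, so \<open>V\<close> is a primitive of
  the continuous function \<open>W\<close>. This is what makes the profile regular where it is joined to the constants.\<close>

lemma has_real_derivative_removable:
  fixes V W :: "real \<Rightarrow> real"
  assumes "finite S" "continuous_on UNIV V" "continuous_on UNIV W"
    and der: "\<And>x. x \<notin> S \<Longrightarrow> (V has_real_derivative W x) (at x)"
  shows "(V has_real_derivative W x) (at x)"
proof -
  define a where "a = x - 1"
  define b where "b = x + 1"
  have ftc: "V u = V a + integral {a..u} W" if "u \<in> {a..b}" for u
  proof -
    have "(W has_integral (V u - V a)) {a..u}"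
      using assms(1) that
      by (intro fundamental_theorem_of_calculus_interior_strong[of S])
         (auto simp: has_real_derivative_iff_has_vector_derivative[symmetric] der
               intro: continuous_on_subset[OF assms(2)])
    then show ?thesis by (simp add: integral_unique)
  qed
  have "((\<lambda>u. V a + integral {a..u} W) has_real_derivative W x) (at x within {a..b})"
    by (auto intro!: derivative_eq_intros integral_has_real_derivative
             continuous_on_subset[OF assms(3)] simp: a_def b_def)
  then have "(V has_real_derivative W x) (at x within {a..b})"
    by (rule has_field_derivative_transform_within[where d = 1])
       (auto intro: ftc[symmetric], auto simp: a_def b_def)
  then show ?thesis
    by (subst (asm) at_within_interior) (auto simp: a_def b_def)
qed

section \<open>Finiteness of the transition time\<close>

lemma has_real_derivative_powr_shift:
  fixes x \<alpha> r :: real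
  assumes "\<alpha> < x"
  shows "((\<lambda>s. (s - \<alpha>) powr r) has_real_derivative r * (x - \<alpha>) powr (r - 1)) (at x)"
  using DERIV_chain2[of "\<lambda>z. z powr r" "r * (x - \<alpha>) powr (r - 1)" "\<lambda>s. s - \<alpha>" x 1 UNIV]
    has_real_derivative_powr[of "x - \<alpha>" r] assms
  by (auto intro!: derivative_eq_intros)

text \<open>Near \<open>\<alpha>\<close> we have \<open>D \<ge> (L/2) (s - \<alpha>)\<^sup>m\<close> and \<open>f \<ge> (f'/2) (s - \<alpha>)\<close>; integrating the product bounds \<open>G\<close>
  below by a multiple of the power \<open>m + 2\<close> of \<open>s - \<alpha>\<close>. Together with \<open>D \<le> 2 L (s - \<alpha>)\<^sup>m\<close> this dominates the integrand by
  a multiple of the power \<open>m/2 - 1 > -1\<close>.\<close>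

lemma transition_time_integrable_left:
  fixes \<alpha> c m f' :: real and D f G :: "real \<Rightarrow> real"
  assumes "\<alpha> < c" "m > 0"
    and DL: "same_order D (\<lambda>s. (s - \<alpha>) powr m) (at_right \<alpha>)"
    and D: "continuous_on {\<alpha>..c} D"
    and f: "f \<alpha> = 0" "(f has_real_derivative f') (at \<alpha>)" "f' > 0"
    and G: "continuous_on {\<alpha>..c} G" "G \<alpha> = 0"
      "\<And>u. u \<in> {\<alpha><..<c} \<Longrightarrow> (G has_real_derivative f u * D u) (at u)"
      "\<And>u. u \<in> {\<alpha><..c} \<Longrightarrow> 0 < G u"
  shows "(\<lambda>s. D s / sqrt (2 * G s)) integrable_on {\<alpha>..c}"
proof -
  obtain L where L: "L > 0" "((\<lambda>s. D s / (s - \<alpha>) powr m) \<longlongrightarrow> L) (at_right \<alpha>)"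
    using DL by (auto simp: same_order_def)
  have "((\<lambda>s. f s / (s - \<alpha>)) \<longlongrightarrow> f') (at_right \<alpha>)"
    using f(1) has_field_derivative_at_within[OF f(2), of "{\<alpha><..}"]
    by (simp add: has_field_derivative_iff)
  then have "eventually (\<lambda>s. f s / (s - \<alpha>) > f' / 2) (at_right \<alpha>)"
    using f(3) by (intro order_tendstoD(1)) auto
  moreover have "eventually (\<lambda>s. D s / (s - \<alpha>) powr m > L / 2) (at_right \<alpha>)"
    using L by (intro order_tendstoD(1)) auto
  moreover have "eventually (\<lambda>s. D s / (s - \<alpha>) powr m < 2 * L) (at_right \<alpha>)"
    using L by (intro order_tendstoD(2)) auto
  moreover have "eventually (\<lambda>s. s < c) (at_right \<alpha>)"
    using \<open>\<alpha> < c\<close> eventually_at_right_real[of \<alpha> c] by (auto elim!: eventually_mono)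
  ultimately have "eventually (\<lambda>s. f s / (s - \<alpha>) > f' / 2 \<and> D s / (s - \<alpha>) powr m > L / 2
      \<and> D s / (s - \<alpha>) powr m < 2 * L \<and> s < c) (at_right \<alpha>)"
    by eventually_elim simp
  then obtain d0 where d0: "d0 > \<alpha>" "\<And>s. \<alpha> < s \<Longrightarrow> s < d0 \<Longrightarrow>
      f s / (s - \<alpha>) > f' / 2 \<and> D s / (s - \<alpha>) powr m > L / 2
      \<and> D s / (s - \<alpha>) powr m < 2 * L \<and> s < c"
    unfolding eventually_at_right_field by auto
  define d where "d = (\<alpha> + d0) / 2"
  have "\<alpha> < d" "d < d0" using d0(1) by (auto simp: d_def)
  then have "d < c" using d0(2)[of d] by simp
  have f_lower: "f s > f' / 2 * (s - \<alpha>)" and D_lower: "D s > L / 2 * (s - \<alpha>) powr m"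
    and D_upper: "D s < 2 * L * (s - \<alpha>) powr m" if "\<alpha> < s" "s \<le> d" for s
    using d0(2)[of s] that \<open>d < d0\<close> by (auto simp: field_simps)
  define k where "k = f' / 2 * (L / 2)"
  have "k > 0" using L f by (simp add: k_def)
  have fD_lower: "f s * D s \<ge> k * (s - \<alpha>) powr (m + 1)" if "\<alpha> < s" "s \<le> d" for s
  proof -
    have "k * (s - \<alpha>) powr (m + 1) = (f' / 2 * (s - \<alpha>)) * (L / 2 * (s - \<alpha>) powr m)"
      using that by (simp add: k_def powr_add)
    also have "\<dots> \<le> f s * D s"
      using f_lower[OF that] D_lower[OF that] that L f(3)
      by (intro mult_mono) (auto intro: order_trans[OF _ less_imp_le[OF f_lower]])
    finally show ?thesis .
  qed
  have G_lower: "G u \<ge> k / (m + 2) * (u - \<alpha>) powr (m + 2)" if "\<alpha> < u" "u \<le> d" for u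
  proof -
    have "G \<alpha> - k / (m + 2) * (\<alpha> - \<alpha>) powr (m + 2)
        \<le> G u - k / (m + 2) * (u - \<alpha>) powr (m + 2)"
    proof (rule DERIV_nonneg_imp_increasing_open[of \<alpha> u "\<lambda>s. G s - k / (m + 2) * (s - \<alpha>) powr (m + 2)"])
      show "\<alpha> \<le> u" using that by simp
      show "continuous_on {\<alpha>..u} (\<lambda>s. G s - k / (m + 2) * (s - \<alpha>) powr (m + 2))"
        using that \<open>d < c\<close> \<open>m > 0\<close>
        by (intro continuous_intros continuous_on_powr' continuous_on_subset[OF G(1)]) auto
      fix x assume x: "\<alpha> < x" "x < u"
      have "((\<lambda>s. G s - k / (m + 2) * (s - \<alpha>) powr (m + 2)) has_real_derivative
          f x * D x - k / (m + 2) * ((m + 2) * (x - \<alpha>) powr (m + 1))) (at x)"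
        using x that \<open>d < c\<close> has_real_derivative_powr_shift[OF x(1), of "m + 2"]
        by (intro DERIV_diff DERIV_cmult G(3)) (auto simp: add.commute)
      moreover have "f x * D x - k / (m + 2) * ((m + 2) * (x - \<alpha>) powr (m + 1)) \<ge> 0"
        using fD_lower[of x] x that \<open>m > 0\<close> by simp
      ultimately show "\<exists>y. ((\<lambda>s. G s - k / (m + 2) * (s - \<alpha>) powr (m + 2)) has_real_derivative y) (at x) \<and> 0 \<le> y"
        by blast
    qed
    then show ?thesis using G(2) by simp
  qed
  define C where "C = 2 * L / sqrt (2 * k / (m + 2))"
  have bound: "norm (D s / sqrt (2 * G s)) \<le> C * (s - \<alpha>) powr (m / 2 - 1)"
    if s: "s \<in> {\<alpha><..<d}" for s
  proof -
    have "sqrt ((s - \<alpha>) powr (m + 2)) = (s - \<alpha>) powr (m / 2 + 1)"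
      by (simp add: powr_half_sqrt[symmetric] powr_powr add_divide_distrib)
    moreover have "2 * k / (m + 2) * (s - \<alpha>) powr (m + 2) \<le> 2 * G s"
      using G_lower[of s] s by simp
    ultimately have low: "sqrt (2 * k / (m + 2)) * (s - \<alpha>) powr (m / 2 + 1) \<le> sqrt (2 * G s)"
      by (metis real_sqrt_le_iff real_sqrt_mult)
    have pos: "0 < sqrt (2 * k / (m + 2))" using \<open>k > 0\<close> \<open>m > 0\<close> by simp
    have "0 < L / 2 * (s - \<alpha>) powr m" using s L by simp
    also have "\<dots> < D s" using D_lower[of s] s by simp
    finally have Dpos: "0 < D s" .
    have "D s / sqrt (2 * G s)
        \<le> 2 * L * (s - \<alpha>) powr m / (sqrt (2 * k / (m + 2)) * (s - \<alpha>) powr (m / 2 + 1))"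
      using D_upper[of s] s Dpos low pos by (intro frac_le) auto
    also have "\<dots> = C * ((s - \<alpha>) powr m / (s - \<alpha>) powr (m / 2 + 1))"
      by (simp add: C_def)
    also have "\<dots> = C * (s - \<alpha>) powr (m / 2 - 1)"
      by (simp add: powr_diff[symmetric])
    finally have "D s / sqrt (2 * G s) \<le> C * (s - \<alpha>) powr (m / 2 - 1)" .
    moreover have "0 \<le> D s / sqrt (2 * G s)"
      using Dpos G(4)[of s] s \<open>d < c\<close> by simp
    ultimately show ?thesis by simp
  qed
  have cont: "continuous_on {\<alpha><..c} (\<lambda>s. D s / sqrt (2 * G s))"
    by (intro continuous_intros continuous_on_subset[OF D] continuous_on_subset[OF G(1)])
       (auto dest: G(4))
  have "((\<lambda>s. C * (s - \<alpha>) powr (m / 2 - 1)) has_integral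
      (C / (m / 2) * (d - \<alpha>) powr (m / 2) - C / (m / 2) * (\<alpha> - \<alpha>) powr (m / 2))) {\<alpha>..d}"
  proof (rule fundamental_theorem_of_calculus_interior)
    show "continuous_on {\<alpha>..d} (\<lambda>s. C / (m / 2) * (s - \<alpha>) powr (m / 2))"
      using \<open>m > 0\<close> by (intro continuous_intros continuous_on_powr') auto
    fix x assume "x \<in> {\<alpha><..<d}"
    then show "((\<lambda>s. C / (m / 2) * (s - \<alpha>) powr (m / 2)) has_vector_derivative
        C * (x - \<alpha>) powr (m / 2 - 1)) (at x)"
      unfolding has_real_derivative_iff_has_vector_derivative[symmetric]
      using \<open>m > 0\<close> by (auto intro!: derivative_eq_intros simp: powr_diff field_simps)
  qed (use \<open>\<alpha> < d\<close> in simp)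
  then have "(\<lambda>s. C * (s - \<alpha>) powr (m / 2 - 1)) integrable_on {\<alpha><..<d}"
    unfolding integrable_on_Icc_iff_Ioo[symmetric] by blast
  then have "(\<lambda>s. D s / sqrt (2 * G s)) integrable_on {\<alpha><..<d}"
  proof (rule measurable_bounded_by_integrable_imp_integrable[rotated, OF _ bound])
    show "(\<lambda>s. D s / sqrt (2 * G s)) \<in> borel_measurable (lebesgue_on {\<alpha><..<d})"
      by (rule continuous_imp_measurable_on_sets_lebesgue[OF continuous_on_subset[OF cont]])
         (use \<open>d < c\<close> in auto)
  qed auto
  then have "(\<lambda>s. D s / sqrt (2 * G s)) integrable_on {\<alpha>..d}"
    unfolding integrable_on_Icc_iff_Ioo[symmetric] .
  moreover have "(\<lambda>s. D s / sqrt (2 * G s)) integrable_on {d..c}"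
    using \<open>\<alpha> < d\<close> by (intro integrable_continuous_real continuous_on_subset[OF cont]) auto
  ultimately show ?thesis
    using \<open>\<alpha> < d\<close> \<open>d < c\<close> by (intro Henstock_Kurzweil_Integration.integrable_combine[of \<alpha> d c]) auto
qed

text \<open>The end \<open>\<beta>\<close> reduces to the end \<open>\<alpha>\<close> by the reflection \<open>s \<mapsto> - s\<close>, which replaces \<open>f\<close> by
  \<open>\<lambda>s. - f (- s)\<close> and so preserves the sign of the derivative of \<open>f\<close> at the end point.\<close>

lemma transition_time_integrable:
  fixes \<alpha> \<beta> m :: real and D f G :: "real \<Rightarrow> real"
  assumes "\<alpha> < \<beta>" "m > 0"
    and D_left: "same_order D (\<lambda>s. (s - \<alpha>) powr m) (at_right \<alpha>)"
    and D_right: "same_order D (\<lambda>s. (\<beta> - s) powr m) (at_left \<beta>)"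
    and D: "continuous_on {\<alpha>..\<beta>} D"
    and f_left: "f \<alpha> = 0" "(f has_real_derivative f1) (at \<alpha>)" "f1 > 0"
    and f_right: "f \<beta> = 0" "(f has_real_derivative f2) (at \<beta>)" "f2 > 0"
    and G: "continuous_on {\<alpha>..\<beta>} G" "G \<alpha> = 0" "G \<beta> = 0"
      "\<And>u. u \<in> {\<alpha><..<\<beta>} \<Longrightarrow> (G has_real_derivative f u * D u) (at u)"
      "\<And>u. u \<in> {\<alpha><..<\<beta>} \<Longrightarrow> 0 < G u"
  shows "(\<lambda>s. D s / sqrt (2 * G s)) integrable_on {\<alpha>..\<beta>}"
proof -
  define c where "c = (\<alpha> + \<beta>) / 2"
  have c: "\<alpha> < c" "c < \<beta>" using \<open>\<alpha> < \<beta>\<close> by (auto simp: c_def)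
  have left: "(\<lambda>s. D s / sqrt (2 * G s)) integrable_on {\<alpha>..c}"
    by (rule transition_time_integrable_left[OF c(1) \<open>m > 0\<close> D_left _ f_left])
       (use c G in \<open>auto intro: continuous_on_subset[OF D] continuous_on_subset[OF G(1)]\<close>)
  have reflect: "continuous_on {-\<beta>..-c} (\<lambda>s. F (- s))" if "continuous_on {\<alpha>..\<beta>} F" for F :: "real \<Rightarrow> real"
    using c by (intro continuous_on_compose2[OF that]) (auto intro!: continuous_intros)
  have "(\<lambda>s. D (- s) / sqrt (2 * G (- s))) integrable_on {-\<beta>..-c}"
  proof (rule transition_time_integrable_left[where f = "\<lambda>s. - f (- s)" and f' = f2 and m = m])
    show "same_order (\<lambda>s. D (- s)) (\<lambda>s. (s - - \<beta>) powr m) (at_right (- \<beta>))"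
      using D_right
      by (simp add: same_order_def at_left_minus[of \<beta>] filterlim_filtermap minus_diff_commute add.commute)
    show "((\<lambda>s. - f (- s)) has_real_derivative f2) (at (- \<beta>))"
      using f_right(2) DERIV_minus[of "\<lambda>s. f (- s)" "- f2" "- \<beta>" UNIV]
        DERIV_mirror[of f f2 "- \<beta>"]
      by simp
    show "((\<lambda>s. G (- s)) has_real_derivative - f (- u) * D (- u)) (at u)" if "u \<in> {- \<beta><..<- c}" for u
    proof -
      have "(G has_real_derivative f (- u) * D (- u)) (at (- u))"
        using that c by (intro G(4)) auto
      then show ?thesis
        using DERIV_mirror[of G "f (- u) * D (- u)" u] by simp
    qed
  qed (use c G f_right \<open>m > 0\<close> in \<open>auto intro: reflect D\<close>)
  then have "(\<lambda>s. D s / sqrt (2 * G s)) integrable_on {c..\<beta>}"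
    using Henstock_Kurzweil_Integration.integrable_reflect_real[of "\<lambda>s. D s / sqrt (2 * G s)" \<beta> c] by simp
  then show ?thesis
    using left c by (intro Henstock_Kurzweil_Integration.integrable_combine[of \<alpha> c \<beta>]) auto
qed

section \<open>The transition profile\<close>

text \<open>The profile is the inverse of \<open>T - T c\<close>, so that it passes through \<open>c\<close> at time \<open>0\<close>, continued by the
  constants \<open>\<alpha>\<close> and \<open>\<beta>\<close> outside the bounded range of \<open>T - T c\<close>. The function \<open>W = sqrt (2 G(\<Phi>))\<close> is the
  flux \<open>K(\<Phi>)'\<close>. Inside the range both derivatives come from the inverse function rule, outside everything
  is constant, and at the two junction times they follow by continuity. The lemma takes \<open>T\<close> as given:
  any primitive that extends continuously to the closed interval will do, and its existence is exactly
  where the degeneracy of \<open>D\<close> enters.\<close>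

lemma transition_profile:
  fixes \<alpha> \<beta> c :: real and D f G K T :: "real \<Rightarrow> real"
  assumes "\<alpha> < c" "c < \<beta>"
    and T: "continuous_on {\<alpha>..\<beta>} T"
      "\<And>u. u \<in> {\<alpha><..<\<beta>} \<Longrightarrow> (T has_real_derivative D u / sqrt (2 * G u)) (at u)"
    and D: "\<And>u. u \<in> {\<alpha><..<\<beta>} \<Longrightarrow> 0 < D u"
    and f: "continuous_on {\<alpha>..\<beta>} f" "f \<alpha> = 0" "f \<beta> = 0"
    and G: "continuous_on {\<alpha>..\<beta>} G" "G \<alpha> = 0" "G \<beta> = 0"
      "\<And>u. u \<in> {\<alpha><..<\<beta>} \<Longrightarrow> (G has_real_derivative f u * D u) (at u)"
      "\<And>u. u \<in> {\<alpha><..<\<beta>} \<Longrightarrow> 0 < G u"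
    and K: "continuous_on {\<alpha>..\<beta>} K"
      "\<And>u. u \<in> {\<alpha><..<\<beta>} \<Longrightarrow> (K has_real_derivative D u) (at u)"
  obtains \<Phi> W :: "real \<Rightarrow> real" and L where
    "L > 0" "continuous_on UNIV \<Phi>" "\<And>x. \<Phi> x \<in> {\<alpha>..\<beta>}"
    "\<And>x. x \<le> - L \<Longrightarrow> \<Phi> x = \<alpha>" "\<And>x. L \<le> x \<Longrightarrow> \<Phi> x = \<beta>"
    "\<And>x. \<Phi> x < c \<longleftrightarrow> x < 0" "\<And>x. c < \<Phi> x \<longleftrightarrow> 0 < x"
    "\<And>x. ((\<lambda>y. K (\<Phi> y)) has_real_derivative W x) (at x)"
    "\<And>x. (W has_real_derivative f (\<Phi> x)) (at x)"
proof -
  have T_less: "T u < T v" if "\<alpha> \<le> u" "u < v" "v \<le> \<beta>" for u v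
  proof (rule DERIV_pos_imp_increasing_open[OF \<open>u < v\<close>])
    show "\<exists>y. (T has_real_derivative y) (at x) \<and> 0 < y" if "u < x" "x < v" for x
      using that \<open>\<alpha> \<le> u\<close> \<open>v \<le> \<beta>\<close> T(2)[of x] D[of x] G(5)[of x] by (intro exI[of _ "D x / sqrt (2 * G x)"]) auto
  qed (use that in \<open>auto intro: continuous_on_subset[OF T(1)]\<close>)
  have T_le_iff: "T u \<le> T v \<longleftrightarrow> u \<le> v" and T_eq_iff: "T u = T v \<longleftrightarrow> u = v"
    if "u \<in> {\<alpha>..\<beta>}" "v \<in> {\<alpha>..\<beta>}" for u v
    using that T_less[of u v] T_less[of v u] by (fastforce simp: not_less[symmetric] neq_iff)+
  have inj: "inj_on T {\<alpha>..\<beta>}" by (auto intro!: inj_onI simp: T_eq_iff)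
  have ab: "\<alpha> < \<beta>" "T \<alpha> < T c" "T c < T \<beta>"
    using assms(1,2) T_less[of \<alpha> c] T_less[of c \<beta>] by auto
  have image_T: "T ` {\<alpha>..\<beta>} = {T \<alpha>..T \<beta>}"
  proof (intro equalityI subsetI)
    fix y assume "y \<in> {T \<alpha>..T \<beta>}"
    then show "y \<in> T ` {\<alpha>..\<beta>}" using IVT'[of T \<alpha> y \<beta>] T(1) ab(1) by auto
  qed (auto simp: T_le_iff)
  \<comment> \<open>Clamping the argument to the range of \<open>T\<close> performs the constant continuation.\<close>
  define clamp where "clamp x = max (T \<alpha>) (min (T \<beta>) (x + T c))" for x
  have clamp_mem: "clamp x \<in> {T \<alpha>..T \<beta>}" for x using ab by (auto simp: clamp_def)
  define \<Phi> where "\<Phi> x = the_inv_into {\<alpha>..\<beta>} T (clamp x)" for x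
  define W where "W x = sqrt (2 * G (\<Phi> x))" for x
  have \<Phi>_mem: "\<Phi> x \<in> {\<alpha>..\<beta>}" and T_\<Phi>: "T (\<Phi> x) = clamp x" for x
    using the_inv_into_into[OF inj, of "clamp x" "{\<alpha>..\<beta>}"] f_the_inv_into_f[OF inj, of "clamp x"]
      clamp_mem[of x] by (auto simp: \<Phi>_def image_T)
  have \<Phi>_iff: "\<Phi> x \<le> u \<longleftrightarrow> clamp x \<le> T u" "u \<le> \<Phi> x \<longleftrightarrow> T u \<le> clamp x"
    "\<Phi> x = u \<longleftrightarrow> clamp x = T u" if "u \<in> {\<alpha>..\<beta>}" for u x
    using T_le_iff[OF \<Phi>_mem[of x] that] T_le_iff[OF that \<Phi>_mem[of x]]
      T_eq_iff[OF \<Phi>_mem[of x] that] by (auto simp: T_\<Phi>)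
  have \<Phi>_cont: "continuous_on UNIV \<Phi>"
    unfolding \<Phi>_def
  proof (rule continuous_on_compose2[OF continuous_on_inv_into[OF T(1) _ inj]])
    show "continuous_on UNIV clamp" unfolding clamp_def by (intro continuous_intros)
  qed (use clamp_mem in \<open>auto simp: image_T\<close>)
  have comp_cont: "continuous_on UNIV (\<lambda>x. F (\<Phi> x))" if "continuous_on {\<alpha>..\<beta>} F" for F :: "real \<Rightarrow> real"
    by (rule continuous_on_compose2[OF that \<Phi>_cont]) (use \<Phi>_mem in auto)
  have W_cont: "continuous_on UNIV W"
    unfolding W_def by (intro continuous_intros comp_cont G(1))
  have left: "\<Phi> x = \<alpha>" if "x \<le> T \<alpha> - T c" for x
    using that ab by (subst \<Phi>_iff(3)) (auto simp: clamp_def)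
  have right: "\<Phi> x = \<beta>" if "T \<beta> - T c \<le> x" for x
    using that ab by (subst \<Phi>_iff(3)) (auto simp: clamp_def)
  define S where "S = {T \<alpha> - T c, T \<beta> - T c}"
  have der: "((\<lambda>y. K (\<Phi> y)) has_real_derivative W x) (at x) \<and>
      (W has_real_derivative f (\<Phi> x)) (at x)" if "x \<notin> S" for x
  proof -
    have const: ?thesis if "open U" "x \<in> U" "\<And>y. y \<in> U \<Longrightarrow> \<Phi> y = q" "G q = 0" "f q = 0" for U q
    proof -
      have ev: "eventually (\<lambda>y. \<Phi> y = q) (nhds x)"
        using that eventually_nhds by blast
      have evK: "eventually (\<lambda>y. K (\<Phi> y) = K q) (nhds x)" and evW: "eventually (\<lambda>y. W y = 0) (nhds x)"
        using ev by (eventually_elim, simp add: W_def that)+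
      have "((\<lambda>y. K (\<Phi> y)) has_real_derivative 0) (at x)"
        by (subst DERIV_cong_ev[OF refl evK refl]) simp
      moreover have "(W has_real_derivative 0) (at x)"
        by (subst DERIV_cong_ev[OF refl evW refl]) simp
      ultimately show ?thesis using that by (simp add: W_def)
    qed
    consider "x < T \<alpha> - T c" | "T \<beta> - T c < x" | "T \<alpha> - T c < x" "x < T \<beta> - T c"
      using \<open>x \<notin> S\<close> by (fastforce simp: S_def)
    then show ?thesis
    proof cases
      case 1
      then show ?thesis by (intro const[of "{..<T \<alpha> - T c}" \<alpha>]) (auto simp: left G f)
    next
      case 2
      then show ?thesis by (intro const[of "{T \<beta> - T c<..}" \<beta>]) (auto simp: right G f)
    next
      case 3
      then have u: "\<Phi> x \<in> {\<alpha><..<\<beta>}"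
        using \<Phi>_iff(1)[of \<alpha> x] \<Phi>_iff(2)[of \<beta> x] ab by (auto simp: clamp_def not_le[symmetric])
      note pos = D[OF u] G(5)[OF u]
      have "((\<lambda>u. T u - T c) has_real_derivative D (\<Phi> x) / sqrt (2 * G (\<Phi> x))) (at (\<Phi> x))"
        by (auto intro!: derivative_eq_intros T(2)[OF u])
      then have "(\<Phi> has_real_derivative inverse (D (\<Phi> x) / sqrt (2 * G (\<Phi> x)))) (at x)"
      proof (rule DERIV_inverse_function)
        show "isCont \<Phi> x" using \<Phi>_cont by (simp add: continuous_on_eq_continuous_at)
        show "T (\<Phi> y) - T c = y" if "T \<alpha> - T c < y" "y < T \<beta> - T c" for y
          using that by (simp add: T_\<Phi> clamp_def)
      qed (use pos 3 in auto)
      then have \<Phi>': "(\<Phi> has_real_derivative sqrt (2 * G (\<Phi> x)) / D (\<Phi> x)) (at x)" by simp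
      have K': "((\<lambda>y. K (\<Phi> y)) has_real_derivative W x) (at x)"
        using DERIV_chain2[OF K(2)[OF u] \<Phi>'] pos by (simp add: W_def)
      have "((\<lambda>y. 2 * G (\<Phi> y)) has_real_derivative 2 * (f (\<Phi> x) * W x)) (at x)"
        using DERIV_cmult[OF DERIV_chain2[OF G(4)[OF u] \<Phi>'], of 2] pos by (simp add: W_def)
      then have "(W has_real_derivative inverse (sqrt (2 * G (\<Phi> x))) / 2 * (2 * (f (\<Phi> x) * W x))) (at x)"
        unfolding W_def using pos by (intro DERIV_chain2[OF DERIV_real_sqrt]) auto
      moreover have "inverse (sqrt (2 * G (\<Phi> x))) / 2 * (2 * (f (\<Phi> x) * W x)) = f (\<Phi> x)"
        using pos by (simp add: W_def)
      ultimately have "(W has_real_derivative f (\<Phi> x)) (at x)" by (simp only:)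
      with K' show ?thesis by blast
    qed
  qed
  show ?thesis
  proof (rule that[of "max (T c - T \<alpha>) (T \<beta> - T c)" \<Phi> W])
    show "\<Phi> x < c \<longleftrightarrow> x < 0" "c < \<Phi> x \<longleftrightarrow> 0 < x" for x
      using \<Phi>_iff(1,2)[of c x] assms(1,2) ab by (auto simp: not_le[symmetric] clamp_def)
    show "((\<lambda>y. K (\<Phi> y)) has_real_derivative W x) (at x)" for x
      by (rule has_real_derivative_removable[of S]) (use der in \<open>auto simp: S_def intro: comp_cont K(1) W_cont\<close>)
    show "(W has_real_derivative f (\<Phi> x)) (at x)" for x
      by (rule has_real_derivative_removable[of S]) (use der in \<open>auto simp: S_def intro: comp_cont f(1) W_cont\<close>)
  qed (use ab \<Phi>_mem \<Phi>_cont in \<open>auto intro: left right\<close>)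
qed

section \<open>The zigzag phase\<close>

text \<open>The exponent makes the function negative to the left of all points of \<open>H\<close>. For finite nonempty
  \<open>H\<close> it is continuous and has slope
  \<open>1\<close> or \<open>-1\<close> except at the midpoints of consecutive points of \<open>H\<close>.\<close>

definition signed_dist :: "real set \<Rightarrow> real \<Rightarrow> real" where
  "signed_dist H x = (-1) ^ Suc (card {q \<in> H. q < x}) * infdist x H"

lemma abs_signed_dist: "\<bar>signed_dist H x\<bar> = infdist x H"
  by (simp add: signed_dist_def abs_mult power_abs infdist_nonneg)

text \<open>Crossing \<open>p\<close> changes the sign just when the distance to \<open>p\<close> has its kink, so near \<open>p\<close> the zigzag is affine.
  Composing it with a smooth profile therefore produces no kink at \<open>p\<close>.\<close>

lemma signed_dist_near:
  assumes "finite H" "p \<in> H"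
    and gap: "\<And>q. q \<in> H \<Longrightarrow> q \<noteq> p \<Longrightarrow> 2 * r \<le> \<bar>q - p\<bar>"
    and x: "\<bar>x - p\<bar> < r"
  shows "signed_dist H x = (-1) ^ card {q \<in> H. q < p} * (x - p)"
proof -
  have "\<bar>x - p\<bar> \<le> dist x q" if "q \<in> H" for q
    using gap[OF that] x by (cases "q = p") (auto simp: dist_real_def)
  then have "\<bar>x - p\<bar> \<le> infdist x H"
    using \<open>p \<in> H\<close> by (subst infdist_notempty) (auto intro: cINF_greatest)
  then have d: "infdist x H = \<bar>x - p\<bar>"
    using infdist_le[OF \<open>p \<in> H\<close>, of x] by (simp add: dist_real_def)
  show ?thesis
  proof (cases "x \<le> p")
    case True
    have "q < x \<longleftrightarrow> q < p" if "q \<in> H" for q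
      using gap[OF that] x True by (cases "q = p") auto
    then have "{q \<in> H. q < x} = {q \<in> H. q < p}" by blast
    then show ?thesis using True by (simp add: signed_dist_def d algebra_simps)
  next
    case False
    have "q < x \<longleftrightarrow> q = p \<or> q < p" if "q \<in> H" for q
      using gap[OF that] x False by (cases "q = p") auto
    then have "{q \<in> H. q < x} = insert p {q \<in> H. q < p}" using \<open>p \<in> H\<close> by blast
    then show ?thesis using False \<open>finite H\<close> by (simp add: signed_dist_def d)
  qed
qed

lemma signed_dist_side_locally_constant:
  assumes "\<bar>y - x\<bar> < infdist x H"
  shows "{q \<in> H. q < y} = {q \<in> H. q < x}"
proof -
  have "q < y \<longleftrightarrow> q < x" if "q \<in> H" for q
    using infdist_le[OF that, of x] assms by (auto simp: dist_real_def abs_if split: if_splits)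
  then show ?thesis by blast
qed

section \<open>Layered solutions\<close>

text \<open>Everything is local. If the distance of \<open>x\<close> to \<open>H\<close> exceeds \<open>\<epsilon> L\<close>, then the transition has been completed and
  \<open>\<phi>\<close> is one of the two equilibria near \<open>x\<close>; this includes the midpoints, where the zigzag has its kinks.
  Otherwise \<open>x\<close> lies within \<open>r\<close> of some \<open>p\<close> in \<open>H\<close>, where the zigzag is affine and \<open>\<phi>\<close> is a single
  rescaled profile. The condition \<open>\<epsilon> L < r\<close> makes these two regions overlap.\<close>

lemma layered_solution:
  fixes \<Phi> W K f \<phi> :: "real \<Rightarrow> real"
  assumes profile: "L > 0" "continuous_on UNIV \<Phi>"
      "\<And>x. x \<le> - L \<Longrightarrow> \<Phi> x = \<alpha>" "\<And>x. L \<le> x \<Longrightarrow> \<Phi> x = \<beta>"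
      "\<And>x. ((\<lambda>y. K (\<Phi> y)) has_real_derivative W x) (at x)"
      "\<And>x. (W has_real_derivative f (\<Phi> x)) (at x)"
    and f: "f \<alpha> = 0" "f \<beta> = 0"
    and H: "finite H" "H \<noteq> {}" "\<And>p q. p \<in> H \<Longrightarrow> q \<in> H \<Longrightarrow> q \<noteq> p \<Longrightarrow> 2 * r \<le> \<bar>q - p\<bar>"
    and \<epsilon>: "0 < \<epsilon>" "\<epsilon> * L < r" and \<sigma>: "\<sigma> = 1 \<or> \<sigma> = - 1"
    and \<phi>: "\<And>x. \<phi> x = \<Phi> (\<sigma> * signed_dist H x / \<epsilon>)"
  shows "isCont \<phi> x"
    and "((\<lambda>y. K (\<phi> y)) has_real_derivative deriv (\<lambda>y. K (\<phi> y)) x) (at x)"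
    and "(deriv (\<lambda>y. K (\<phi> y)) has_real_derivative f (\<phi> x) / \<epsilon>\<^sup>2) (at x)"
    and "\<epsilon> * L < infdist x H \<Longrightarrow> (\<phi> has_real_derivative 0) (at x)"
proof -
  define V where "V = (\<lambda>y. K (\<phi> y))"
  \<comment> \<open>The claims at \<open>x\<close> depend only on the germ of \<open>\<phi>\<close> at \<open>x\<close>, so they pass from a local model
    \<open>\<psi>\<close> with flux \<open>w\<close> to \<open>\<phi>\<close>.\<close>
  have local_model: "isCont \<phi> x \<and> (V has_real_derivative deriv V x) (at x) \<and>
      (deriv V has_real_derivative f (\<phi> x) / \<epsilon>\<^sup>2) (at x)"
    if ev: "eventually (\<lambda>y. \<phi> y = \<psi> y) (nhds x)" and "isCont \<psi> x"
      and K\<psi>: "\<And>y. ((\<lambda>y. K (\<psi> y)) has_real_derivative w y) (at y)"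
      and w: "(w has_real_derivative f (\<psi> x) / \<epsilon>\<^sup>2) (at x)" for \<psi> w
  proof -
    have evV: "eventually (\<lambda>y. V y = K (\<psi> y)) (nhds x)"
      using ev by eventually_elim (simp add: V_def)
    then have "eventually (\<lambda>y. eventually (\<lambda>z. V z = K (\<psi> z)) (nhds y)) (nhds x)"
      by (simp add: eventually_eventually)
    then have ev': "eventually (\<lambda>y. deriv V y = w y) (nhds x)"
    proof eventually_elim
      case (elim y)
      have "(V has_real_derivative w y) (at y)"
        by (subst DERIV_cong_ev[OF refl elim refl]) (rule K\<psi>)
      then show ?case by (rule DERIV_imp_deriv)
    qed
    have eqs: "\<phi> x = \<psi> x" "deriv V x = w x"
      using eventually_nhds_x_imp_x[OF ev] eventually_nhds_x_imp_x[OF ev'] by auto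
    have "(V has_real_derivative deriv V x) (at x)"
      by (subst DERIV_cong_ev[OF refl evV eqs(2)]) (rule K\<psi>)
    moreover have "(deriv V has_real_derivative f (\<phi> x) / \<epsilon>\<^sup>2) (at x)"
      using w by (subst DERIV_cong_ev[OF refl ev' refl]) (simp add: eqs)
    moreover have "isCont \<phi> x"
      using \<open>isCont \<psi> x\<close> isCont_cong[OF ev] by simp
    ultimately show ?thesis by blast
  qed
  have far: "eventually (\<lambda>y. \<phi> y = \<phi> x) (nhds x) \<and> (\<phi> x = \<alpha> \<or> \<phi> x = \<beta>)"
    if "\<epsilon> * L < infdist x H"
  proof -
    define d where "d = infdist x H - \<epsilon> * L"
    have "d > 0" "d < infdist x H" using that \<epsilon> profile(1) by (auto simp: d_def)
    define s where "s = \<sigma> * (-1) ^ Suc (card {q \<in> H. q < x})"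
    have s: "s = 1 \<or> s = -1"
      using \<sigma> by (cases "even (card {q \<in> H. q < x})") (auto simp: s_def)
    have *: "\<phi> y = (if s = 1 then \<beta> else \<alpha>)" if "\<bar>y - x\<bar> < d" for y
    proof -
      have "infdist x H \<le> infdist y H + dist x y" by (rule infdist_triangle)
      then have "\<epsilon> * L \<le> infdist y H" using that by (simp add: d_def dist_real_def)
      then have "L \<le> infdist y H / \<epsilon>" using \<epsilon> by (simp add: field_simps)
      moreover have "\<phi> y = \<Phi> (s * (infdist y H / \<epsilon>))"
        using signed_dist_side_locally_constant[of y x H] that \<open>d < infdist x H\<close>
        by (simp add: \<phi> signed_dist_def s_def mult.assoc)
      ultimately show ?thesis using s profile(3,4) by auto
    qed
    have "eventually (\<lambda>y. \<bar>y - x\<bar> < d) (nhds x)"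
      using \<open>d > 0\<close> by (auto simp: eventually_nhds_metric dist_real_def)
    then have "eventually (\<lambda>y. \<phi> y = \<phi> x) (nhds x)"
      by eventually_elim (use * \<open>d > 0\<close> in auto)
    then show ?thesis using *[of x] \<open>d > 0\<close> by auto
  qed
  have "isCont \<phi> x \<and> (V has_real_derivative deriv V x) (at x) \<and>
      (deriv V has_real_derivative f (\<phi> x) / \<epsilon>\<^sup>2) (at x)"
  proof (cases "\<epsilon> * L < infdist x H")
    case True
    from far[OF this] f have "f (\<phi> x) = 0" by auto
    with far[OF True] show ?thesis
      by (intro local_model[of "\<lambda>_. \<phi> x" "\<lambda>_. 0"]) auto
  next
    case False
    obtain p where p: "p \<in> H" "infdist x H = dist x p"
      using infdist_attains_inf[of H x] H finite_imp_closed by blast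
    \<comment> \<open>\<open>\<tau>\<close> is the direction of the transition at \<open>p\<close>. Only its square enters the equation: this is the
      reflection symmetry.\<close>
    define \<tau> where "\<tau> = \<sigma> * (-1) ^ card {q \<in> H. q < p}"
    have \<tau>: "\<tau> * \<tau> = 1"
      using \<sigma> by (auto simp: \<tau>_def power_mult_distrib[symmetric])
    have "eventually (\<lambda>y. \<bar>y - p\<bar> < r) (nhds x)"
    proof -
      have "\<bar>x - p\<bar> < r" using False p \<epsilon> by (simp add: dist_real_def)
      moreover have "open {y. \<bar>y - p\<bar> < r}" by (intro open_Collect_less continuous_intros)
      ultimately show ?thesis using eventually_nhds by blast
    qed
    then have ev: "eventually (\<lambda>y. \<phi> y = \<Phi> (\<tau> / \<epsilon> * (y - p))) (nhds x)"
      by eventually_elim (simp add: \<phi> \<tau>_def mult.assoc signed_dist_near[OF H(1) p(1) H(3)[OF p(1)]])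
    have lin: "((\<lambda>y. \<tau> / \<epsilon> * (y - p)) has_real_derivative \<tau> / \<epsilon>) (at y)" for y
      using \<epsilon>(1) by (auto intro!: derivative_eq_intros)
    show ?thesis
    proof (rule local_model[OF ev, of "\<lambda>y. W (\<tau> / \<epsilon> * (y - p)) * (\<tau> / \<epsilon>)"])
      show "isCont (\<lambda>y. \<Phi> (\<tau> / \<epsilon> * (y - p))) x"
        using profile(2) by (intro isCont_o2[of x "\<lambda>y. \<tau> / \<epsilon> * (y - p)" \<Phi>] DERIV_isCont[OF lin])
          (simp add: continuous_on_eq_continuous_at)
      show "((\<lambda>y. K (\<Phi> (\<tau> / \<epsilon> * (y - p)))) has_real_derivative W (\<tau> / \<epsilon> * (y - p)) * (\<tau> / \<epsilon>)) (at y)" for y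
        by (rule DERIV_chain2[OF profile(5) lin])
      have "((\<lambda>y. W (\<tau> / \<epsilon> * (y - p)) * (\<tau> / \<epsilon>)) has_real_derivative
          f (\<Phi> (\<tau> / \<epsilon> * (x - p))) * (\<tau> / \<epsilon>) * (\<tau> / \<epsilon>)) (at x)"
        by (intro DERIV_cmult_right DERIV_chain2[OF profile(6) lin])
      moreover have "f (\<Phi> (\<tau> / \<epsilon> * (x - p))) * (\<tau> / \<epsilon>) * (\<tau> / \<epsilon>) = f (\<Phi> (\<tau> / \<epsilon> * (x - p))) / \<epsilon>\<^sup>2"
        using \<tau> by (simp add: power2_eq_square)
      ultimately show "((\<lambda>y. W (\<tau> / \<epsilon> * (y - p)) * (\<tau> / \<epsilon>)) has_real_derivative
          f (\<Phi> (\<tau> / \<epsilon> * (x - p))) / \<epsilon>\<^sup>2) (at x)" by simp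
    qed
  qed
  then show "isCont \<phi> x"
    and "((\<lambda>y. K (\<phi> y)) has_real_derivative deriv (\<lambda>y. K (\<phi> y)) x) (at x)"
    and "(deriv (\<lambda>y. K (\<phi> y)) has_real_derivative f (\<phi> x) / \<epsilon>\<^sup>2) (at x)"
    unfolding V_def by auto
  show "(\<phi> has_real_derivative 0) (at x)" if "\<epsilon> * L < infdist x H"
    using far[OF that] by (subst DERIV_cong_ev[OF refl conjunct1[OF far[OF that]] refl]) simp
qed

text \<open>At an end point of the piece that belongs to \<open>h ` {1..N}\<close> the number of points to the left may differ
  from \<open>j\<close>, but there the distance vanishes and the sign is irrelevant.\<close>

lemma signed_dist_piece:
  assumes mono: "strict_mono_on {1..N} h" and "j \<le> N" "x \<in> piece a b N h j"
  shows "signed_dist (h ` {1..N}) x = (-1) ^ Suc j * infdist x (h ` {1..N})"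
proof (cases "x \<in> h ` {1..N}")
  case True
  then show ?thesis by (simp add: signed_dist_def)
next
  case False
  have "h i < x \<longleftrightarrow> i \<le> j" if i: "i \<in> {1..N}" for i
  proof
    assume "i \<le> j"
    then have "h i \<le> h j" "j \<in> {1..N}"
      using i \<open>j \<le> N\<close> strict_mono_on_leD[OF mono, of i j] by auto
    moreover have "h j \<le> x" using \<open>x \<in> piece a b N h j\<close> i \<open>i \<le> j\<close> by (auto simp: piece_def split: if_splits)
    moreover have "h i \<noteq> x" using False i by blast
    ultimately show "h i < x" by simp
  next
    assume "h i < x"
    show "i \<le> j"
    proof (rule ccontr)
      assume "\<not> i \<le> j"
      then have "h (Suc j) \<le> h i" "j \<noteq> N"
        using i strict_mono_on_leD[OF mono, of "Suc j" i] by auto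
      then show False using \<open>h i < x\<close> \<open>x \<in> piece a b N h j\<close> by (auto simp: piece_def split: if_splits)
    qed
  qed
  then have "{q \<in> h ` {1..N}. q < x} = h ` {1..j}"
    using \<open>j \<le> N\<close> by auto
  moreover have "card (h ` {1..j}) = j"
    using card_image[OF inj_on_subset[OF strict_mono_on_imp_inj_on[OF mono], of "{1..j}"]] \<open>j \<le> N\<close> by simp
  ultimately show ?thesis by (simp add: signed_dist_def)
qed

text \<open>The point \<open>h j + d\<close> serves for every piece but the first, where \<open>h 1 - d\<close> does. With \<open>d = \<epsilon> L\<close> this is
  where the transition has just been completed.\<close>

lemma piece_contains_point_at_distance:
  assumes mono: "strict_mono_on {1..N} h" and "N \<ge> 1" "j \<le> N"
    and gap: "\<And>p q. p \<in> h ` {1..N} \<Longrightarrow> q \<in> h ` {1..N} \<Longrightarrow> q \<noteq> p \<Longrightarrow> 2 * r \<le> \<bar>q - p\<bar>"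
    and ends: "r \<le> h 1 - a" "r \<le> b - h N" and d: "0 < d" "d < r"
  shows "\<exists>x\<in>piece a b N h j. infdist x (h ` {1..N}) = d"
proof -
  have near: "infdist x (h ` {1..N}) = d" if "p \<in> h ` {1..N}" "\<bar>x - p\<bar> = d" for x p
    using signed_dist_near[of "h ` {1..N}" p r x] that gap[OF that(1)] d
    by (simp add: abs_signed_dist[symmetric] abs_mult power_abs)
  show ?thesis
  proof (cases "j = 0")
    case True
    have "h 1 - d \<in> piece a b N h j"
      using True \<open>N \<ge> 1\<close> ends d by (auto simp: piece_def)
    moreover have "infdist (h 1 - d) (h ` {1..N}) = d"
      using \<open>N \<ge> 1\<close> d by (intro near[of "h 1"]) auto
    ultimately show ?thesis by blast
  next
    case False
    have j: "j \<in> {1..N}" using False \<open>j \<le> N\<close> by simp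
    have "2 * r \<le> h (Suc j) - h j" if "j \<noteq> N"
    proof -
      have "Suc j \<in> {1..N}" using that \<open>j \<le> N\<close> by simp
      moreover from this have "h j < h (Suc j)"
        using j strict_mono_onD[OF mono] by simp
      ultimately show ?thesis
        using gap[of "h j" "h (Suc j)"] j by simp
    qed
    then have "h j + d \<in> piece a b N h j"
      using False ends d by (cases "j = N") (simp_all add: piece_def)
    moreover have "infdist (h j + d) (h ` {1..N}) = d"
      using j d by (intro near[of "h j"]) auto
    ultimately show ?thesis by blast
  qed
qed

lemma finite_gap:
  fixes H :: "real set"
  assumes "finite H"
  obtains r where "r > 0" "\<And>p q. p \<in> H \<Longrightarrow> q \<in> H \<Longrightarrow> q \<noteq> p \<Longrightarrow> r \<le> \<bar>q - p\<bar>"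
proof -
  define S where "S = insert 1 ((\<lambda>(p, q). \<bar>q - p\<bar>) ` {(p, q) \<in> H \<times> H. q \<noteq> p})"
  have "finite S"
    using assms unfolding S_def by (auto intro: finite_subset[of _ "H \<times> H"])
  then have "Min S > 0" by (subst Min_gr_iff) (auto simp: S_def)
  moreover have "Min S \<le> \<bar>q - p\<bar>" if "p \<in> H" "q \<in> H" "q \<noteq> p" for p q
    using that by (intro Min_le[OF \<open>finite S\<close>]) (auto simp: S_def)
  ultimately show ?thesis by (rule that)
qed


text \<open>On a piece the zigzag has constant sign, which keeps \<open>\<phi>\<close> on one side of \<open>c\<close> and thus away from the far
  equilibrium; the near one is attained at distance \<open>\<epsilon> L\<close> from an end point of the piece.\<close>

lemma signed_dist_transitions:
  fixes \<Phi> \<phi> :: "real \<Rightarrow> real"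
  assumes profile: "\<alpha> < c" "c < \<beta>"
      "\<And>x. x \<le> - L \<Longrightarrow> \<Phi> x = \<alpha>" "\<And>x. L \<le> x \<Longrightarrow> \<Phi> x = \<beta>"
      "\<And>x. \<Phi> x < c \<longleftrightarrow> x < 0" "\<And>x. c < \<Phi> x \<longleftrightarrow> 0 < x"
    and mono: "strict_mono_on {1..N} h" and "N \<ge> 1" "j \<le> N"
    and gap: "\<And>p q. p \<in> h ` {1..N} \<Longrightarrow> q \<in> h ` {1..N} \<Longrightarrow> q \<noteq> p \<Longrightarrow> 2 * r \<le> \<bar>q - p\<bar>"
    and ends: "r \<le> h 1 - a" "r \<le> b - h N"
    and \<epsilon>: "0 < \<epsilon>" "0 < L" "\<epsilon> * L < r"
    and \<phi>: "\<And>x. \<phi> x = \<Phi> (\<sigma> * signed_dist (h ` {1..N}) x / \<epsilon>)"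
  shows "\<sigma> * (-1) ^ j = 1 \<Longrightarrow> \<alpha> \<in> \<phi> ` piece a b N h j \<and> \<beta> \<notin> \<phi> ` piece a b N h j"
    and "\<sigma> * (-1) ^ j = -1 \<Longrightarrow> \<beta> \<in> \<phi> ` piece a b N h j \<and> \<alpha> \<notin> \<phi> ` piece a b N h j"
proof -
  have \<phi>_piece: "\<phi> x = \<Phi> (- (\<sigma> * (-1) ^ j) * (infdist x (h ` {1..N}) / \<epsilon>))"
    if "x \<in> piece a b N h j" for x
    using signed_dist_piece[OF mono \<open>j \<le> N\<close> that] by (simp add: \<phi> mult.assoc)
  have nonneg: "0 \<le> infdist x (h ` {1..N}) / \<epsilon>" for x
    using \<epsilon> by (simp add: infdist_nonneg)
  obtain x where x: "x \<in> piece a b N h j" "infdist x (h ` {1..N}) = \<epsilon> * L"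
    using piece_contains_point_at_distance[OF mono \<open>N \<ge> 1\<close> \<open>j \<le> N\<close> gap ends, of "\<epsilon> * L"] \<epsilon> by auto
  show "\<alpha> \<in> \<phi> ` piece a b N h j \<and> \<beta> \<notin> \<phi> ` piece a b N h j" if s: "\<sigma> * (-1) ^ j = 1"
  proof
    have "\<phi> x = \<alpha>" using \<phi>_piece[OF x(1)] x(2) \<epsilon> profile(3)[of "- L"] by (simp add: s)
    then show "\<alpha> \<in> \<phi> ` piece a b N h j" using x(1) by blast
    have "\<not> c < \<phi> y" if "y \<in> piece a b N h j" for y
      using \<phi>_piece[OF that] nonneg[of y] profile(6) by (simp add: s not_less)
    then show "\<beta> \<notin> \<phi> ` piece a b N h j" using profile(2) by auto
  qed
  show "\<beta> \<in> \<phi> ` piece a b N h j \<and> \<alpha> \<notin> \<phi> ` piece a b N h j" if s: "\<sigma> * (-1) ^ j = -1"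
  proof
    have "\<phi> x = \<beta>" using \<phi>_piece[OF x(1)] x(2) \<epsilon> profile(4)[of L] by (simp add: s)
    then show "\<beta> \<in> \<phi> ` piece a b N h j" using x(1) by blast
    have "\<not> \<phi> y < c" if "y \<in> piece a b N h j" for y
      using \<phi>_piece[OF that] nonneg[of y] profile(5) by (simp add: s not_less)
    then show "\<alpha> \<notin> \<phi> ` piece a b N h j" using profile(1) by auto
  qed
qed

section \<open>Existence of two oscillating solutions\<close>

lemma has_real_derivative_LBINT:
  fixes g :: "real \<Rightarrow> real"
  assumes "\<alpha> \<le> \<beta>" "continuous_on {\<alpha>..\<beta>} g"
  shows "continuous_on {\<alpha>..\<beta>} (\<lambda>u. LBINT s=ereal \<alpha>..ereal u. g s)"
    and "u \<in> {\<alpha><..<\<beta>} \<Longrightarrow> ((\<lambda>u. LBINT s=ereal \<alpha>..ereal u. g s) has_real_derivative g u) (at u)"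
proof -
  have within: "((\<lambda>u. LBINT s=ereal \<alpha>..ereal u. g s) has_real_derivative g u) (at u within {\<alpha>..\<beta>})"
    if "u \<in> {\<alpha>..\<beta>}" for u
    using interval_integral_FTC2[of \<alpha> \<alpha> \<beta> g u] assms that
    by (simp add: has_real_derivative_iff_has_vector_derivative)
  then show "continuous_on {\<alpha>..\<beta>} (\<lambda>u. LBINT s=ereal \<alpha>..ereal u. g s)"
    by (rule DERIV_continuous_on)
  show "((\<lambda>u. LBINT s=ereal \<alpha>..ereal u. g s) has_real_derivative g u) (at u)" if "u \<in> {\<alpha><..<\<beta>}"
    using within[of u] that at_within_interior[of u "{\<alpha>..\<beta>}"] by simp
qed

theorem proposition4:
  fixes I :: "real set" and \<alpha> \<beta> a b m :: real and D f :: "real \<Rightarrow> real"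
    and N :: nat and h :: "nat \<Rightarrow> real"
  assumes "open I" and "is_interval I"
    and "\<alpha> < \<beta>" and "{\<alpha>..\<beta>} \<subseteq> I"
    and "D C1_differentiable_on I"
    and "f C1_differentiable_on I" and "deriv f C1_differentiable_on I"
    and "\<And>u. u \<in> I - {\<alpha>, \<beta>} \<Longrightarrow> D u > 0"
    and "m \<ge> 1"
    and "same_order D (\<lambda>s. (s - \<alpha>) powr m) (at_right \<alpha>)"
    and "same_order D (\<lambda>s. (\<beta> - s) powr m) (at_left \<beta>)"
    and "f \<alpha> = 0" and "f \<beta> = 0"
    and "deriv f \<alpha> > 0" and "deriv f \<beta> > 0"
    and "(LBINT s=ereal \<alpha>..ereal \<beta>. f s * D s) = 0"
    and "\<And>u. u \<in> I - {\<alpha>, \<beta>} \<Longrightarrow> (LBINT s=ereal \<alpha>..ereal u. f s * D s) > 0"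
    and "a < b" and "N \<ge> 1"
    and "a < h 1" and "strict_mono_on {1..N} h" and "h N < b"
  shows "\<exists>\<epsilon>0>0. \<forall>\<epsilon>. 0 < \<epsilon> \<and> \<epsilon> < \<epsilon>0 \<longrightarrow>
    (\<exists>\<phi>1 \<phi>2.
       stationary_solution D f \<alpha> \<beta> \<epsilon> a b \<phi>1 \<and>
       stationary_solution D f \<alpha> \<beta> \<epsilon> a b \<phi>2 \<and>
       \<phi>1 a = \<alpha> \<and> \<phi>2 a = \<beta> \<and>
       oscillates \<alpha> \<beta> a b N h \<phi>1 \<and>
       oscillates \<beta> \<alpha> a b N h \<phi>2 \<and>
       (\<forall>x\<in>{a..b}. \<phi>1 x = (\<alpha> + \<beta>) / 2 \<longleftrightarrow> x \<in> h ` {1..N}) \<and>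
       (\<forall>x\<in>{a..b}. \<phi>2 x = (\<alpha> + \<beta>) / 2 \<longleftrightarrow> x \<in> h ` {1..N}))"
proof -
  have ab: "{\<alpha><..<\<beta>} \<subseteq> I - {\<alpha>, \<beta>}" using \<open>{\<alpha>..\<beta>} \<subseteq> I\<close> by auto
  have D_cont: "continuous_on {\<alpha>..\<beta>} D" and f_cont: "continuous_on {\<alpha>..\<beta>} f"
    using assms(4-6) by (blast intro: continuous_on_subset C1_differentiable_imp_continuous_on)+
  have f_der: "(f has_real_derivative deriv f u) (at u)" if "u \<in> {\<alpha>..\<beta>}" for u
    using assms(4,6) that by (auto simp: C1_differentiable_on_eq DERIV_deriv_iff_real_differentiable)
  define G where "G u = (LBINT s=ereal \<alpha>..ereal u. f s * D s)" for u
  define K where "K = D_primitive D \<alpha>"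
  define g where "g s = D s / sqrt (2 * G s)" for s
  define T where "T u = integral {\<alpha>..u} g" for u
  define c where "c = (\<alpha> + \<beta>) / 2"
  have c: "\<alpha> < c" "c < \<beta>" using \<open>\<alpha> < \<beta>\<close> by (auto simp: c_def)
  have D_pos: "0 < D u" and G_pos: "0 < G u" if "u \<in> {\<alpha><..<\<beta>}" for u
    using that ab assms(8,17) unfolding G_def by blast+
  have fD_cont: "continuous_on {\<alpha>..\<beta>} (\<lambda>s. f s * D s)"
    by (intro continuous_intros f_cont D_cont)
  have G: "continuous_on {\<alpha>..\<beta>} G" "G \<alpha> = 0" "G \<beta> = 0"
    "\<And>u. u \<in> {\<alpha><..<\<beta>} \<Longrightarrow> (G has_real_derivative f u * D u) (at u)"
    using has_real_derivative_LBINT[OF less_imp_le[OF \<open>\<alpha> < \<beta>\<close>] fD_cont] assms(16)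
    unfolding G_def[abs_def] by simp_all
  have K: "continuous_on {\<alpha>..\<beta>} K"
    "\<And>u. u \<in> {\<alpha><..<\<beta>} \<Longrightarrow> (K has_real_derivative D u) (at u)"
    using has_real_derivative_LBINT[OF less_imp_le[OF \<open>\<alpha> < \<beta>\<close>] D_cont]
    unfolding K_def D_primitive_def[abs_def] by simp_all
  have g_int: "g integrable_on {\<alpha>..\<beta>}"
    unfolding g_def using \<open>\<alpha> < \<beta>\<close> \<open>m \<ge> 1\<close> f_der[of \<alpha>] f_der[of \<beta>] assms(10-15) D_cont G G_pos
    by (intro transition_time_integrable[of \<alpha> \<beta> m D f "deriv f \<alpha>" "deriv f \<beta>" G]) auto
  have T: "continuous_on {\<alpha>..\<beta>} T"
    unfolding T_def by (rule indefinite_integral_continuous_1[OF g_int])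
  have T_der: "(T has_real_derivative D u / sqrt (2 * G u)) (at u)" if u: "u \<in> {\<alpha><..<\<beta>}" for u
  proof -
    have "isCont D u"
      using continuous_on_interior[OF D_cont, of u] u by simp
    then have "isCont g u"
      unfolding g_def using G_pos[OF u] DERIV_isCont[OF G(4)[OF u]] by (intro continuous_intros) auto
    then have "(T has_real_derivative g u) (at u within {\<alpha>..\<beta>})"
      using integral_has_vector_derivative_continuous_at[OF g_int, of u "{}"] u
      by (auto simp: T_def[abs_def] has_real_derivative_iff_has_vector_derivative
               intro: continuous_at_imp_continuous_at_within)
    then show ?thesis using u by (subst (asm) at_within_interior) (auto simp: g_def)
  qed
  obtain \<Phi> W L where profile: "L > 0" "continuous_on UNIV \<Phi>" "\<And>x. \<Phi> x \<in> {\<alpha>..\<beta>}"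
    "\<And>x. x \<le> - L \<Longrightarrow> \<Phi> x = \<alpha>" "\<And>x. L \<le> x \<Longrightarrow> \<Phi> x = \<beta>"
    "\<And>x. \<Phi> x < c \<longleftrightarrow> x < 0" "\<And>x. c < \<Phi> x \<longleftrightarrow> 0 < x"
    "\<And>x. ((\<lambda>y. K (\<Phi> y)) has_real_derivative W x) (at x)"
    "\<And>x. (W has_real_derivative f (\<Phi> x)) (at x)"
  proof (rule transition_profile[of \<alpha> c \<beta> T D G f K, OF c T T_der D_pos f_cont \<open>f \<alpha> = 0\<close> \<open>f \<beta> = 0\<close>
        G G_pos K], goal_cases)
    \<comment> \<open>The first five goals are the trivial domain conditions of the conditional facts among the arguments.\<close>
    case 6
    show ?case by (rule 6(1)) (fact 6)+
  qed auto
  define H where "H = h ` {1..N}"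
  have H: "finite H" "H \<noteq> {}" using \<open>N \<ge> 1\<close> by (auto simp: H_def)
  obtain r0 where r0: "r0 > 0" "\<And>p q. p \<in> H \<Longrightarrow> q \<in> H \<Longrightarrow> q \<noteq> p \<Longrightarrow> r0 \<le> \<bar>q - p\<bar>"
    using finite_gap[OF H(1)] by blast
  \<comment> \<open>Transitions of half-width below \<open>r\<close> overlap neither each other nor the ends of \<open>[a,b]\<close>, so that the solution
    is constant near \<open>a\<close> and \<open>b\<close> and satisfies the Neumann conditions.\<close>
  define r where "r = min (r0 / 2) (min (h 1 - a) (b - h N))"
  have r: "r > 0" "r \<le> h 1 - a" "r \<le> b - h N"
    using r0(1) \<open>a < h 1\<close> \<open>h N < b\<close> by (auto simp: r_def)
  have gap: "2 * r \<le> \<bar>q - p\<bar>" if "p \<in> H" "q \<in> H" "q \<noteq> p" for p q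
  proof -
    have "2 * r \<le> r0" by (simp add: r_def min_def)
    then show ?thesis using r0(2)[OF that] by linarith
  qed
  have between: "h 1 \<le> p \<and> p \<le> h N" if "p \<in> H" for p
    using that strict_mono_on_leD[OF \<open>strict_mono_on {1..N} h\<close>] by (auto simp: H_def)
  have end_dist: "r \<le> infdist a H" "r \<le> infdist b H"
    using between r(2,3) H(2)
    by (auto simp: infdist_notempty dist_real_def intro!: cINF_greatest) (fastforce+)
  define \<phi> where "\<phi> \<epsilon> \<sigma> x = \<Phi> (\<sigma> * signed_dist H x / \<epsilon>)" for \<epsilon> \<sigma> x
  have solution: "stationary_solution D f \<alpha> \<beta> \<epsilon> a b (\<phi> \<epsilon> \<sigma>)"
    if \<epsilon>: "0 < \<epsilon>" "\<epsilon> * L < r" and \<sigma>: "\<sigma> = 1 \<or> \<sigma> = -1" for \<epsilon> \<sigma>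
  proof -
    note layered = layered_solution[OF profile(1,2,4,5,8,9) \<open>f \<alpha> = 0\<close> \<open>f \<beta> = 0\<close> H gap \<epsilon> \<sigma> \<phi>_def]
    have mem: "\<phi> \<epsilon> \<sigma> x \<in> {\<alpha>..\<beta>}" for x unfolding \<phi>_def by (rule profile(3))
    have cont: "continuous_on {a..b} (\<phi> \<epsilon> \<sigma>)"
      using layered(1) by (intro continuous_at_imp_continuous_on) auto
    have cont_f: "continuous_on {a..b} (\<lambda>x. f (\<phi> \<epsilon> \<sigma> x) / \<epsilon>\<^sup>2)"
      using \<epsilon> mem by (intro continuous_intros continuous_on_compose2[OF f_cont cont]) auto
    have "((\<phi> \<epsilon> \<sigma>) has_real_derivative 0) (at a)" "((\<phi> \<epsilon> \<sigma>) has_real_derivative 0) (at b)"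
      using layered(4) end_dist \<epsilon>(2) by auto
    then show ?thesis
      unfolding stationary_solution_def K_def[symmetric]
      using cont mem cont_f \<epsilon>(1)
      by (intro conjI exI[of _ "deriv (\<lambda>y. K (\<phi> \<epsilon> \<sigma> y))"] exI[of _ "\<lambda>x. f (\<phi> \<epsilon> \<sigma> x) / \<epsilon>\<^sup>2"])
         (auto intro: has_field_derivative_at_within layered(2,3))
  qed
  have zeros: "\<phi> \<epsilon> \<sigma> x = (\<alpha> + \<beta>) / 2 \<longleftrightarrow> x \<in> h ` {1..N}"
    if \<epsilon>: "0 < \<epsilon>" and \<sigma>: "\<sigma> = 1 \<or> \<sigma> = -1" for \<epsilon> \<sigma> x
  proof -
    have "\<phi> \<epsilon> \<sigma> x = c \<longleftrightarrow> \<sigma> * signed_dist H x / \<epsilon> = 0"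
      unfolding \<phi>_def using profile(6,7)[of "\<sigma> * signed_dist H x / \<epsilon>"] by linarith
    also have "\<dots> \<longleftrightarrow> infdist x H = 0"
      using \<epsilon> \<sigma> abs_signed_dist[of H x] by auto
    also have "\<dots> \<longleftrightarrow> x \<in> H"
      using in_closed_iff_infdist_zero[of H x] H finite_imp_closed by auto
    finally show ?thesis by (simp add: c_def H_def)
  qed
  have osc: "oscillates \<alpha> \<beta> a b N h (\<phi> \<epsilon> 1)" "oscillates \<beta> \<alpha> a b N h (\<phi> \<epsilon> (-1))"
    if \<epsilon>: "0 < \<epsilon>" "\<epsilon> * L < r" for \<epsilon>
  proof -
    have transitions:
      "\<sigma> * (-1) ^ j = 1 \<Longrightarrow> \<alpha> \<in> \<phi> \<epsilon> \<sigma> ` piece a b N h j \<and> \<beta> \<notin> \<phi> \<epsilon> \<sigma> ` piece a b N h j"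
      "\<sigma> * (-1) ^ j = -1 \<Longrightarrow> \<beta> \<in> \<phi> \<epsilon> \<sigma> ` piece a b N h j \<and> \<alpha> \<notin> \<phi> \<epsilon> \<sigma> ` piece a b N h j"
      if "j \<le> N" for j \<sigma>
      using signed_dist_transitions[OF c profile(4-7) \<open>strict_mono_on {1..N} h\<close> \<open>N \<ge> 1\<close> that
          gap[unfolded H_def] r(2,3) \<epsilon>(1) profile(1) \<epsilon>(2), of "\<phi> \<epsilon> \<sigma>" \<sigma>]
      by (auto simp: \<phi>_def H_def)
    have mem: "\<phi> \<epsilon> \<sigma> x \<in> {\<alpha>..\<beta>}" for \<sigma> x unfolding \<phi>_def by (rule profile(3))
    show "oscillates \<alpha> \<beta> a b N h (\<phi> \<epsilon> 1)" "oscillates \<beta> \<alpha> a b N h (\<phi> \<epsilon> (-1))"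
      using mem \<open>\<alpha> < \<beta>\<close> transitions[of _ 1] transitions[of _ "-1"]
      by (auto simp: oscillates_def min_def max_def)
  qed
  have start: "\<phi> \<epsilon> 1 a = \<alpha>" "\<phi> \<epsilon> (-1) a = \<beta>" if \<epsilon>: "0 < \<epsilon>" "\<epsilon> * L < r" for \<epsilon>
  proof -
    have "{q \<in> H. q < a} = {}" using between \<open>a < h 1\<close> by fastforce
    then have "signed_dist H a = - infdist a H" unfolding signed_dist_def by (simp only:) simp
    moreover have "L \<le> infdist a H / \<epsilon>" using end_dist(1) \<epsilon> by (simp add: field_simps)
    ultimately show "\<phi> \<epsilon> 1 a = \<alpha>" "\<phi> \<epsilon> (-1) a = \<beta>"
      using profile(4,5) by (auto simp: \<phi>_def)
  qed
  show ?thesis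
  proof (intro exI[of _ "r / L"] conjI allI impI)
    show "r / L > 0" using r profile(1) by simp
    fix \<epsilon> assume "0 < \<epsilon> \<and> \<epsilon> < r / L"
    then have \<epsilon>: "0 < \<epsilon>" "\<epsilon> * L < r" using profile(1) by (auto simp: field_simps)
    show "\<exists>\<phi>1 \<phi>2.
       stationary_solution D f \<alpha> \<beta> \<epsilon> a b \<phi>1 \<and>
       stationary_solution D f \<alpha> \<beta> \<epsilon> a b \<phi>2 \<and>
       \<phi>1 a = \<alpha> \<and> \<phi>2 a = \<beta> \<and>
       oscillates \<alpha> \<beta> a b N h \<phi>1 \<and>
       oscillates \<beta> \<alpha> a b N h \<phi>2 \<and>
       (\<forall>x\<in>{a..b}. \<phi>1 x = (\<alpha> + \<beta>) / 2 \<longleftrightarrow> x \<in> h ` {1..N}) \<and>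
       (\<forall>x\<in>{a..b}. \<phi>2 x = (\<alpha> + \<beta>) / 2 \<longleftrightarrow> x \<in> h ` {1..N})"
      by (rule exI[of _ "\<phi> \<epsilon> 1"], rule exI[of _ "\<phi> \<epsilon> (-1)"])
         (intro conjI ballI solution[OF \<epsilon>] start[OF \<epsilon>] osc[OF \<epsilon>] zeros[OF \<epsilon>(1)], simp_all)
  qed
qed

end
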